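(* Let problem (P), problems (P)$^\nu$ ($\nu\in\mathbb{N}$) and their minimum values $\mathfrak{m}$, $\mathfrak{m}^\nu$ be as defined in the context. Assume all of the following. (A1) $X\subset\mathbb{R}^n$, $Y\subset\mathbb{R}^m$, $D\subset\mathbb{R}^q$ are nonempty and closed. (A2) The sets $Y^\nu$, $\nu\in\mathbb{N}$, are nonempty subsets of $Y$ and $Y^\nu\to Y$ in the sense of Painlevé–Kuratowski. (A3) For a sequence $\delta^\nu\to 0$, the functions $g,g^\nu:\mathbb{R}^n\times\mathbb{R}^m\to\mathbb{R}$ satisfy $\sup_{x\in X,y\in Y}|g^\nu(x,y)-g(x,y)|\le\delta^\nu$ for all $\nu\in\mathbb{N}$, and $g$ is continuous relative to $X\times Y$. (A4) For a sequence $\eta^\nu\to 0$, the mappings $H,H^\nu:\mathbb{R}^n\times\mathbb{R}^m\to\mathbb{R}^q$ satisfy $\sup_{x\in X,y\in Y}\big|\operatorname{dist}(H^\nu(x,y),D)-\operatorname{dist}(H(x,y),D)\big|\le\eta^\nu$ for all $\nu\in\mathbb{N}$, and $H$ is continuous relative to $X\times Y$. (A5) For all $x\in X$ and $y\in Y$, the functions $f,f^\nu:\mathbb{R}^n\times\mathbb{R}^m\to(-\infty,\infty]$ satisfy $\limsup_\nu f^\nu(x,y)\le f(x,y)$, and $\liminf_\nu f^\nu(x^\nu,y^\nu)\ge f(x,y)$ whenever $x^\nu\in X\to x$ and $y^\nu\in Y\to y$. (A6) The nonnegative parameters $\sigma^\nu,\theta^\nu,\bar\lambda^\nu$ satisfy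 $\bar\lambda^\nu\to\infty$, $\sigma^\nu\eta^\nu\to0$, $\theta^\nu\bar\lambda^\nu\eta^\nu\to0$, and $\theta^\nu\delta^\nu\to0$. Then the following hold: (a) If $\{\theta^\nu,\nu\in\mathbb{N}\}$ is bounded away from zero, $\theta^\nu|\tau^\nu-\tau'|\to0$ for some $\tau'>\tau$, and $Y$ is compact, then $\limsup_\nu\mathfrak{m}^\nu\le\mathfrak{m}$. (b) Suppose there is a compact set $B\subset\mathbb{R}^{n+m+q+2}$ such that for each $\nu\in\mathbb{N}$ there exists an optimal solution of (P)$^\nu$ in $B$. If $\theta^\nu|\tau^\nu-\tau|\to0$ and $\sigma^\nu,\theta^\nu\to\infty$, then $\liminf_\nu\mathfrak{m}^\nu\ge\mathfrak{m}$, and moreover $\{\mathfrak{m}^\nu\}$ converges to a real number when $\liminf_\nu\mathfrak{m}^\nu$ is finite. (c) Suppose that $\theta^\nu|\tau^\nu-\tau|\to0$, $\sigma^\nu\to\infty$, $\theta^\nu\to\infty$, and there are $x\in X$, $y\in Y$, and $\lambda\in[0,\infty)$ such that $$f(x,y)<\infty,\quad H(x,y)\in D,\quad g(x,y)\le\inf_{z\in Y}\big\{g(x,z)+\lambda\operatorname{dist}(H(x,z),D)\big\}+\tau.\qquad( * )$$ For every $\nu\in\mathbb{N}$, let $(x^\nu,y^\nu,u^\nu,\alpha^\nu,\lambda^\nu)$ be an $\epsilon^\nu$-optimal solution of (P)$^\nu$, where $\epsilon^\nu\in[0,\infty)$. If $\{\epsilon^\nu,\nu\in\mathbb{N}\}$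 is bounded and there are a subsequence $N\subset\mathbb{N}$ and a point $(\hat x,\hat y,\hat u,\hat\alpha,\hat\lambda)$ such that $(x^\nu,y^\nu,u^\nu,\alpha^\nu,\lambda^\nu)\to(\hat x,\hat y,\hat u,\hat\alpha,\hat\lambda)$ along $\nu\in N$, then $(\hat x,\hat y)$ is feasible in (P). Furthermore, if $Y$ is compact, $\tau\in(0,\infty)$, and $f$ is real-valued, then the existence of $x\in X$, $y\in Y$, $\lambda\in[0,\infty)$ satisfying $( * )$ is guaranteed by the existence of a feasible point in (P).
   Context: Fix an arbitrary norm $\|\cdot\|$ on $\mathbb{R}^q$; for $a\in\mathbb{R}^q$, $\operatorname{dist}(a,D)=\inf_{a'\in D}\|a-a'\|$. Infima over the empty set equal $\infty$. Problem (P), with $\tau\in[0,\infty)$: minimize $f(x,y)$ over $x\in X$, $y\in\mathbb{R}^m$ subject to $y\in\tau\text{-}\operatorname{argmin}_{z\in Y}\{g(x,z)\mid H(x,z)\in D\}$; that is, $y\in Y$, $H(x,y)\in D$ and $g(x,y)\le\inf_{z\in Y}\{g(x,z)\mid H(x,z)\in D\}+\tau$. A point is feasible in (P) if it satisfies these constraints and $f(x,y)<\infty$. $\mathfrak{m}$ is the infimum of $f(x,y)$ over points satisfying the stated constraints ($\infty$ if there are none). Problem (P)$^\nu$, with parameters $\sigma^\nu,\theta^\nu,\bar\lambda^\nu,\tau^\nu\in[0,\infty)$: minimize $f^\nu(x,y)+\sigma^\nu\|u\|-\theta^\nu\alpha$ over $(x,y,u,\alpha,\lambda)$ subject to $H^\nu(x,y)+u\in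 D$; $\;g^\nu(x,y)+\alpha\le g^\nu(x,z)+\lambda\operatorname{dist}(H^\nu(x,z),D)+\tau^\nu$ for all $z\in Y^\nu$; $\;x\in X$, $y\in Y$, $u\in\mathbb{R}^q$, $\alpha\in(-\infty,0]$, $\lambda\in[0,\bar\lambda^\nu]$. $\mathfrak{m}^\nu$ is the infimum of its objective function over points satisfying these constraints ($\infty$ if there are none). For $\epsilon\in[0,\infty)$, an $\epsilon$-optimal solution of (P)$^\nu$ is a point satisfying its constraints with objective value finite and at most $\mathfrak{m}^\nu+\epsilon$; an optimal solution is a $0$-optimal solution. $Y^\nu\to Y$ in the sense of Painlevé–Kuratowski means that $Y$ is closed and the distance from $y$ to $Y^\nu$ converges to the distance from $y$ to $Y$ for all $y\in\mathbb{R}^m$. A function $\psi$ is continuous relative to a set $C$ if $\psi(w^\nu)\to\psi(w)$ whenever $w^\nu\in C\to w\in C$. A subsequence $N\subset\mathbb{N}$ is an infinite subset of indices. *)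

theory Defs
  imports "HOL-Analysis.Analysis"
begin

text \<open>An arbitrary norm on \<open>\<real>\<^sup>q\<close> is a function, since the type class fixes the Euclidean norm.\<close>

definition is_norm :: "('a::real_vector \<Rightarrow> real) \<Rightarrow> bool" where
  "is_norm nrm \<longleftrightarrow>
     (\<forall>a. 0 \<le> nrm a) \<and> (\<forall>a. nrm a = 0 \<longleftrightarrow> a = 0) \<and>
     (\<forall>c a. nrm (c *\<^sub>R a) = \<bar>c\<bar> * nrm a) \<and>
     (\<forall>a b. nrm (a + b) \<le> nrm a + nrm b)"

text \<open>Real-valued, hence meaningful only for nonempty \<open>D\<close>.\<close>

definition dist_to :: "('a::real_vector \<Rightarrow> real) \<Rightarrow> 'a \<Rightarrow> 'a set \<Rightarrow> real" where
  "dist_to nrm a D = (INF a'\<in>D. nrm (a - a'))"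

text \<open>Painleve-Kuratowski convergence; to be used for nonempty sets only, since
  \<^const>\<open>infdist\<close> to the empty set is \<open>0\<close> instead of \<open>\<infinity>\<close>.\<close>

definition PK_converges :: "(nat \<Rightarrow> 'a::metric_space set) \<Rightarrow> 'a set \<Rightarrow> bool" where
  "PK_converges Ys Y \<longleftrightarrow> closed Y \<and> (\<forall>y. (\<lambda>\<nu>. infdist y (Ys \<nu>)) \<longlonglongrightarrow> infdist y Y)"

text \<open>The bilevel problem (P): minimize \<open>f x y\<close> where \<open>y\<close> is a \<open>\<tau>\<close>-minimizer of \<open>g x\<close> over
  \<open>z \<in> Y\<close> with \<open>H x z \<in> D\<close>. Infima are taken in \<^typ>\<open>ereal\<close>, so that they are \<open>\<infinity>\<close> over the empty
  set and \<open>-\<infinity>\<close> if unbounded below.\<close>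

definition constraints_P ::
  "'x set \<Rightarrow> 'y set \<Rightarrow> 'u set \<Rightarrow> ('x \<Rightarrow> 'y \<Rightarrow> real) \<Rightarrow> ('x \<Rightarrow> 'y \<Rightarrow> 'u) \<Rightarrow> real
   \<Rightarrow> 'x \<Rightarrow> 'y \<Rightarrow> bool" where
  "constraints_P X Y D g H \<tau> x y \<longleftrightarrow>
     x \<in> X \<and> y \<in> Y \<and> H x y \<in> D \<and>
     ereal (g x y) \<le> (INF z\<in>{z \<in> Y. H x z \<in> D}. ereal (g x z)) + ereal \<tau>"

definition feasible_P ::
  "'x set \<Rightarrow> 'y set \<Rightarrow> 'u set \<Rightarrow> ('x \<Rightarrow> 'y \<Rightarrow> ereal) \<Rightarrow> ('x \<Rightarrow> 'y \<Rightarrow> real) \<Rightarrow> ('x \<Rightarrow> 'y \<Rightarrow> 'u) \<Rightarrow> real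
   \<Rightarrow> 'x \<Rightarrow> 'y \<Rightarrow> bool" where
  "feasible_P X Y D f g H \<tau> x y \<longleftrightarrow> constraints_P X Y D g H \<tau> x y \<and> f x y < \<infinity>"

definition minval_P ::
  "'x set \<Rightarrow> 'y set \<Rightarrow> 'u set \<Rightarrow> ('x \<Rightarrow> 'y \<Rightarrow> ereal) \<Rightarrow> ('x \<Rightarrow> 'y \<Rightarrow> real) \<Rightarrow> ('x \<Rightarrow> 'y \<Rightarrow> 'u) \<Rightarrow> real
   \<Rightarrow> ereal" where
  "minval_P X Y D f g H \<tau> = (INF (x, y)\<in>{(x, y). constraints_P X Y D g H \<tau> x y}. f x y)"

text \<open>The approximating problem (P)\<open>\<^sup>\<nu>\<close> for a single index \<open>\<nu>\<close>: the arguments \<open>Y'\<close>, \<open>f'\<close>, \<open>g'\<close>, \<open>H'\<close>, \<open>\<sigma>\<close>, \<open>\<theta>\<close>,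
  \<open>lbar\<close>, \<open>\<tau>'\<close> stand for \<open>Y\<^sup>\<nu>\<close>, \<open>f\<^sup>\<nu>\<close>, \<open>g\<^sup>\<nu>\<close>, \<open>H\<^sup>\<nu>\<close>, \<open>\<sigma>\<^sup>\<nu>\<close>, \<open>\<theta>\<^sup>\<nu>\<close>, the upper bound on \<open>\<lambda>\<close>, and \<open>\<tau>\<^sup>\<nu>\<close>.
  Its variables form a tuple \<open>(x, y, u, \<alpha>, l)\<close> with \<open>l\<close> standing for \<open>\<lambda>\<close>.\<close>

definition constraints_Pnu ::
  "('u::real_vector \<Rightarrow> real) \<Rightarrow> 'x set \<Rightarrow> 'y set \<Rightarrow> 'u set \<Rightarrow> 'y set
   \<Rightarrow> ('x \<Rightarrow> 'y \<Rightarrow> real) \<Rightarrow> ('x \<Rightarrow> 'y \<Rightarrow> 'u) \<Rightarrow> real \<Rightarrow> real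
   \<Rightarrow> 'x \<times> 'y \<times> 'u \<times> real \<times> real \<Rightarrow> bool" where
  "constraints_Pnu nrm X Y D Y' g' H' lbar \<tau>' = (\<lambda>(x, y, u, \<alpha>, l).
     H' x y + u \<in> D \<and>
     (\<forall>z\<in>Y'. g' x y + \<alpha> \<le> g' x z + l * dist_to nrm (H' x z) D + \<tau>') \<and>
     x \<in> X \<and> y \<in> Y \<and> \<alpha> \<le> 0 \<and> 0 \<le> l \<and> l \<le> lbar)"

definition objective_Pnu ::
  "('u \<Rightarrow> real) \<Rightarrow> ('x \<Rightarrow> 'y \<Rightarrow> ereal) \<Rightarrow> real \<Rightarrow> real
   \<Rightarrow> 'x \<times> 'y \<times> 'u \<times> real \<times> real \<Rightarrow> ereal" where
  "objective_Pnu nrm f' \<sigma> \<theta> = (\<lambda>(x, y, u, \<alpha>, l). f' x y + ereal (\<sigma> * nrm u) - ereal (\<theta> * \<alpha>))"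

definition minval_Pnu ::
  "('u::real_vector \<Rightarrow> real) \<Rightarrow> 'x set \<Rightarrow> 'y set \<Rightarrow> 'u set \<Rightarrow> 'y set
   \<Rightarrow> ('x \<Rightarrow> 'y \<Rightarrow> ereal) \<Rightarrow> ('x \<Rightarrow> 'y \<Rightarrow> real) \<Rightarrow> ('x \<Rightarrow> 'y \<Rightarrow> 'u)
   \<Rightarrow> real \<Rightarrow> real \<Rightarrow> real \<Rightarrow> real \<Rightarrow> ereal" where
  "minval_Pnu nrm X Y D Y' f' g' H' \<sigma> \<theta> lbar \<tau>' =
     (INF w\<in>{w. constraints_Pnu nrm X Y D Y' g' H' lbar \<tau>' w}. objective_Pnu nrm f' \<sigma> \<theta> w)"

definition eps_optimal_Pnu ::
  "('u::real_vector \<Rightarrow> real) \<Rightarrow> 'x set \<Rightarrow> 'y set \<Rightarrow> 'u set \<Rightarrow> 'y set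
   \<Rightarrow> ('x \<Rightarrow> 'y \<Rightarrow> ereal) \<Rightarrow> ('x \<Rightarrow> 'y \<Rightarrow> real) \<Rightarrow> ('x \<Rightarrow> 'y \<Rightarrow> 'u)
   \<Rightarrow> real \<Rightarrow> real \<Rightarrow> real \<Rightarrow> real \<Rightarrow> real \<Rightarrow> 'x \<times> 'y \<times> 'u \<times> real \<times> real \<Rightarrow> bool" where
  "eps_optimal_Pnu nrm X Y D Y' f' g' H' \<sigma> \<theta> lbar \<tau>' \<epsilon> w \<longleftrightarrow>
     constraints_Pnu nrm X Y D Y' g' H' lbar \<tau>' w \<and>
     \<bar>objective_Pnu nrm f' \<sigma> \<theta> w\<bar> \<noteq> \<infinity> \<and>
     objective_Pnu nrm f' \<sigma> \<theta> w \<le> minval_Pnu nrm X Y D Y' f' g' H' \<sigma> \<theta> lbar \<tau>' + ereal \<epsilon>"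

abbreviation optimal_Pnu ::
  "('u::real_vector \<Rightarrow> real) \<Rightarrow> 'x set \<Rightarrow> 'y set \<Rightarrow> 'u set \<Rightarrow> 'y set
   \<Rightarrow> ('x \<Rightarrow> 'y \<Rightarrow> ereal) \<Rightarrow> ('x \<Rightarrow> 'y \<Rightarrow> real) \<Rightarrow> ('x \<Rightarrow> 'y \<Rightarrow> 'u)
   \<Rightarrow> real \<Rightarrow> real \<Rightarrow> real \<Rightarrow> real \<Rightarrow> 'x \<times> 'y \<times> 'u \<times> real \<times> real \<Rightarrow> bool" where
  "optimal_Pnu nrm X Y D Y' f' g' H' \<sigma> \<theta> lbar \<tau>' \<equiv>
     eps_optimal_Pnu nrm X Y D Y' f' g' H' \<sigma> \<theta> lbar \<tau>' 0"

text \<open>A point that is \<open>\<tau>\<close>-optimal in the lower level with its constraint penalized by the finite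
  multiplier \<open>l\<close>.\<close>

definition penalty_point ::
  "('u::real_vector \<Rightarrow> real) \<Rightarrow> 'x set \<Rightarrow> 'y set \<Rightarrow> 'u set
   \<Rightarrow> ('x \<Rightarrow> 'y \<Rightarrow> ereal) \<Rightarrow> ('x \<Rightarrow> 'y \<Rightarrow> real) \<Rightarrow> ('x \<Rightarrow> 'y \<Rightarrow> 'u) \<Rightarrow> real
   \<Rightarrow> 'x \<Rightarrow> 'y \<Rightarrow> real \<Rightarrow> bool" where
  "penalty_point nrm X Y D f g H \<tau> x y l \<longleftrightarrow>
     x \<in> X \<and> y \<in> Y \<and> 0 \<le> l \<and> f x y < \<infinity> \<and> H x y \<in> D \<and>
     ereal (g x y) \<le> (INF z\<in>Y. ereal (g x z + l * dist_to nrm (H x z) D)) + ereal \<tau>"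

end

theory Submission
  imports Defs
begin

text \<open>
  Weak inequalities pass to the limit in (P)\<open>\<^sup>\<nu>\<close> as long as the multipliers stay bounded: the
  growing penalties \<open>\<sigma>\<^sup>\<nu>\<close> and \<open>\<theta>\<^sup>\<nu>\<close> force \<open>u\<close> and \<open>\<alpha>\<close> to vanish whenever the objective values are
  bounded above, so a cluster point satisfies the penalized lower-level condition with a finite
  multiplier.  Conversely, any point satisfying that condition becomes feasible in (P)\<open>\<^sup>\<nu>\<close> after a
  correction \<open>u\<close> of size \<open>\<eta>\<^sup>\<nu>\<close> and \<open>\<alpha>\<close> of size \<open>2\<delta>\<^sup>\<nu> + \<lambda>\<eta>\<^sup>\<nu> + \<bar>\<tau>\<^sup>\<nu> - \<tau>\<bar>\<close>, whose cost vanishes, so its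
  \<open>f\<close>-value bounds the upper limit of the minimum values.  On compact \<open>Y\<close>, a finite penalty
  parameter reproduces the lower-level infimum up to any positive tolerance.
\<close>

section \<open>Norms and point-to-set distance\<close>

lemma is_norm_eq_0_iff: "is_norm nrm \<Longrightarrow> nrm a = 0 \<longleftrightarrow> a = 0"
  unfolding is_norm_def by blast

lemma is_norm_uminus: "is_norm nrm \<Longrightarrow> nrm (- a) = nrm a"
  unfolding is_norm_def by (metis abs_minus_cancel abs_one mult_1 scaleR_minus1_left)

text \<open>Homogeneity and the triangle inequality make \<open>nrm\<close> convex, and a
  real-valued convex function on a Euclidean space is continuous.\<close>

lemma is_norm_continuous:
  fixes nrm :: "'a::euclidean_space \<Rightarrow> real"
  assumes "is_norm nrm"
  shows "continuous_on UNIV nrm"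
proof -
  have "convex_on UNIV nrm"
  proof (rule convex_onI)
    fix t :: real and x y :: 'a assume "0 < t" "t < 1"
    have "nrm ((1 - t) *\<^sub>R x + t *\<^sub>R y) \<le> nrm ((1 - t) *\<^sub>R x) + nrm (t *\<^sub>R y)"
      using assms unfolding is_norm_def by blast
    also have "\<dots> = (1 - t) * nrm x + t * nrm y"
      using assms \<open>0 < t\<close> \<open>t < 1\<close> unfolding is_norm_def by simp
    finally show "nrm ((1 - t) *\<^sub>R x + t *\<^sub>R y) \<le> (1 - t) * nrm x + t * nrm y" .
  qed simp
  then show ?thesis
    by (intro convex_on_continuous) auto
qed

text \<open>The constant is the minimum of \<open>nrm\<close> over the compact Euclidean unit
  sphere. It is positive because the minimizer is nonzero, and homogeneity carries the bound to all
  vectors.\<close>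

lemma is_norm_lower_bound:
  fixes nrm :: "'a::euclidean_space \<Rightarrow> real"
  assumes "is_norm nrm"
  shows "\<exists>c>0. \<forall>a. c * norm a \<le> nrm a"
proof -
  have "\<exists>x\<in>sphere (0::'a) 1. \<forall>y\<in>sphere 0 1. nrm x \<le> nrm y"
    by (intro continuous_attains_inf)
      (auto intro: continuous_on_subset[OF is_norm_continuous[OF assms]])
  then obtain x :: 'a where x: "norm x = 1" "\<And>y. norm y = 1 \<Longrightarrow> nrm x \<le> nrm y"
    by (auto simp: dist_norm)
  have "nrm x > 0"
    using assms x(1) unfolding is_norm_def by (metis norm_zero order_less_le zero_neq_one)
  moreover have "nrm x * norm a \<le> nrm a" for a
  proof (cases "a = 0")
    case False
    have "nrm x \<le> nrm (inverse (norm a) *\<^sub>R a)"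
      using False by (intro x(2)) auto
    also have "\<dots> = nrm a / norm a"
      using assms unfolding is_norm_def by (simp add: divide_inverse mult.commute)
    finally show ?thesis
      using False by (simp add: field_simps)
  qed (use assms in \<open>simp add: is_norm_def\<close>)
  ultimately show ?thesis by blast
qed

lemma dist_to_bdd_below: "is_norm nrm \<Longrightarrow> bdd_below ((\<lambda>a'. nrm (a - a')) ` D)"
  by (rule bdd_belowI[of _ 0]) (auto simp: is_norm_def)

lemma dist_to_le: "is_norm nrm \<Longrightarrow> d \<in> D \<Longrightarrow> dist_to nrm a D \<le> nrm (a - d)"
  unfolding dist_to_def by (rule cINF_lower[OF dist_to_bdd_below])

lemma dist_to_nonneg: "is_norm nrm \<Longrightarrow> D \<noteq> {} \<Longrightarrow> 0 \<le> dist_to nrm a D"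
  unfolding dist_to_def by (rule cINF_greatest) (auto simp: is_norm_def)

lemma dist_to_mem:
  assumes "is_norm nrm" "a \<in> D"
  shows "dist_to nrm a D = 0"
proof (rule antisym)
  show "dist_to nrm a D \<le> 0"
    using dist_to_le[OF assms, of a] is_norm_eq_0_iff[OF assms(1), of 0] by simp
  show "0 \<le> dist_to nrm a D"
    using assms by (intro dist_to_nonneg) auto
qed

lemma dist_to_attained:
  fixes D :: "'a::euclidean_space set"
  assumes "is_norm nrm" "closed D" "D \<noteq> {}"
  shows "\<exists>d\<in>D. dist_to nrm a D = nrm (a - d)"
proof -
  obtain d0 where d0: "d0 \<in> D" using assms by blast
  obtain c where c: "c > 0" "\<And>a. c * norm a \<le> nrm a"
    using is_norm_lower_bound[OF assms(1)] by blast
  \<comment> \<open>The radius comes from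
    \<open>c * norm (a - d) \<le> nrm (a - d) \<le> nrm (a - d0)\<close>: every point of
    \<open>D\<close> at least as close as \<open>d0\<close> lies in this Euclidean ball, so the
    infimum over \<open>D\<close> reduces to one over a compact set.\<close>
  define K where "K = D \<inter> cball a (nrm (a - d0) / c)"
  have K: "d \<in> K" if "d \<in> D" "nrm (a - d) \<le> nrm (a - d0)" for d
  proof -
    have "c * norm (a - d) \<le> nrm (a - d0)"
      using c(2)[of "a - d"] that(2) by linarith
    then show ?thesis
      using c(1) that(1) by (simp add: K_def dist_norm field_simps)
  qed
  have "continuous_on K (\<lambda>d. nrm (a - d))"
    by (intro continuous_on_compose2[OF is_norm_continuous[OF assms(1)]] continuous_intros) auto
  moreover have "compact K" "K \<noteq> {}"
    using assms(2) K[OF d0] by (auto simp: K_def closed_Int_compact)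
  ultimately obtain d where d: "d \<in> K" "\<And>e. e \<in> K \<Longrightarrow> nrm (a - d) \<le> nrm (a - e)"
    using continuous_attains_inf[of K "\<lambda>d. nrm (a - d)"] by blast
  have "nrm (a - d) \<le> nrm (a - e)" if "e \<in> D" for e
    using d K[OF d0] K[OF that] by (meson linear order_trans)
  then have "nrm (a - d) \<le> dist_to nrm a D"
    unfolding dist_to_def using assms(3) by (intro cINF_greatest) auto
  then show ?thesis
    using d(1) dist_to_le[OF assms(1), of d D a] by (force simp: K_def)
qed

lemma dist_to_eq_0_iff:
  fixes D :: "'a::euclidean_space set"
  assumes "is_norm nrm" "closed D" "D \<noteq> {}"
  shows "dist_to nrm a D = 0 \<longleftrightarrow> a \<in> D"
proof
  assume "dist_to nrm a D = 0"
  then obtain d where "d \<in> D" "nrm (a - d) = 0"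
    using dist_to_attained[OF assms, of a] by auto
  then show "a \<in> D"
    using is_norm_eq_0_iff[OF assms(1), of "a - d"] by simp
qed (rule dist_to_mem[OF assms(1)])

text \<open>The distance to \<open>D\<close> is 1-Lipschitz with respect to \<open>nrm\<close>, and
  \<open>nrm\<close> itself is continuous in the Euclidean topology.\<close>

lemma dist_to_continuous:
  fixes D :: "'a::euclidean_space set"
  assumes "is_norm nrm" "closed D" "D \<noteq> {}"
  shows "continuous_on UNIV (\<lambda>a. dist_to nrm a D)"
proof -
  have lip: "dist_to nrm a D \<le> dist_to nrm b D + nrm (a - b)" for a b
  proof -
    obtain d where d: "d \<in> D" "dist_to nrm b D = nrm (b - d)"
      using dist_to_attained[OF assms] by blast
    have "dist_to nrm a D \<le> nrm ((a - b) + (b - d))"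
      using dist_to_le[OF assms(1) d(1), of a] by simp
    also have "\<dots> \<le> nrm (a - b) + nrm (b - d)"
      using assms(1) unfolding is_norm_def by blast
    finally show ?thesis using d by simp
  qed
  have "((\<lambda>x. dist_to nrm x D) \<longlongrightarrow> dist_to nrm a D) (at a)" for a
  proof (rule LIM_zero_cancel)
    have "((\<lambda>x. nrm (x - a)) \<longlongrightarrow> nrm (a - a)) (at a)"
      by (rule continuous_on_tendsto_compose[OF is_norm_continuous[OF assms(1)]
            tendsto_diff[OF tendsto_ident_at tendsto_const]]) auto
    then have lim: "((\<lambda>x. nrm (x - a)) \<longlongrightarrow> 0) (at a)"
      using is_norm_eq_0_iff[OF assms(1), of 0] by simp
    have "norm (dist_to nrm x D - dist_to nrm a D) \<le> nrm (x - a)" for x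
      using lip[of a x] lip[of x a] is_norm_uminus[OF assms(1), of "x - a"] by simp
    then have le: "\<forall>\<^sub>F x in at a. norm (dist_to nrm x D - dist_to nrm a D) \<le> nrm (x - a)"
      by simp
    show "((\<lambda>x. dist_to nrm x D - dist_to nrm a D) \<longlongrightarrow> 0) (at a)"
      by (rule Lim_null_comparison[OF le lim])
  qed
  then show ?thesis
    by (simp add: continuous_on_def)
qed

section \<open>Exact penalization up to a tolerance\<close>

text \<open>Only points of the compact sublevel set \<open>K\<close> can need a penalty. Since
  \<open>v < V\<close>, no zero of \<open>d\<close> lies in \<open>K\<close>, so \<open>d\<close>
  has a positive minimum there and a finite multiplier suffices.\<close>

lemma exists_penalty_parameter:
  fixes \<phi> d :: "'a::topological_space \<Rightarrow> real"
  assumes "compact Y" "continuous_on Y \<phi>" "continuous_on Y d" "\<And>z. z \<in> Y \<Longrightarrow> 0 \<le> d z"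
    and V: "\<And>z. z \<in> Y \<Longrightarrow> d z = 0 \<Longrightarrow> V \<le> \<phi> z" and "v < V"
  shows "\<exists>l\<ge>0. \<forall>z\<in>Y. v \<le> \<phi> z + l * d z"
proof -
  define K where "K = {z \<in> Y. \<phi> z \<le> v}"
  have "compact K"
    using closedin_compact[OF assms(1) continuous_closedin_preimage[OF assms(2) closed_atMost]]
    by (simp add: K_def vimage_def Int_def)
  show ?thesis
  proof (cases "K = {}")
    case True
    then have "\<forall>z\<in>Y. v \<le> \<phi> z + 0 * d z"
      by (force simp: K_def)
    then show ?thesis by blast
  next
    case False
    have "continuous_on K \<phi>" "continuous_on K d"
      using assms(2,3) by (auto simp: K_def intro: continuous_on_subset)
    then obtain z0 z1 where z: "z0 \<in> K" "\<And>z. z \<in> K \<Longrightarrow> \<phi> z0 \<le> \<phi> z"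
      "z1 \<in> K" "\<And>z. z \<in> K \<Longrightarrow> d z1 \<le> d z"
      using continuous_attains_inf[OF \<open>compact K\<close> False] by metis
    have d1: "d z1 > 0"
      using z(3) assms(4)[of z1] V[of z1] \<open>v < V\<close> by (force simp: K_def)
    \<comment> \<open>The largest deficit \<open>v - \<phi> z0\<close> on \<open>K\<close> divided
      by the smallest value \<open>d z1\<close>; hence \<open>l * d z\<close> covers the deficit at
      every point of \<open>K\<close>.\<close>
    define l where "l = (v - \<phi> z0) / d z1"
    have l: "0 \<le> l"
      using d1 z(1) by (simp add: l_def K_def)
    have "v \<le> \<phi> z + l * d z" if "z \<in> Y" for z
    proof (cases "z \<in> K")
      case True
      have "l * d z1 \<le> l * d z"
        using l z(4)[OF True] by (rule mult_left_mono[rotated])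
      moreover have "l * d z1 = v - \<phi> z0"
        using d1 by (simp add: l_def)
      ultimately show ?thesis
        using z(2)[OF True] by linarith
    next
      case False
      then have "v \<le> \<phi> z" using that by (simp add: K_def)
      moreover have "0 \<le> l * d z" using l assms(4)[OF that] by simp
      ultimately show ?thesis by linarith
    qed
    then show ?thesis using l by blast
  qed
qed

text \<open>A finite \<open>t\<close> can be moved across the inequality even when the infimum is
  infinite, so an empty \<open>S\<close> gives truth on both sides. This turns extended-real
  constraints into pointwise real inequalities.\<close>

lemma ereal_le_INF_add_iff:
  "ereal a \<le> (INF z\<in>S. ereal (h z)) + ereal t \<longleftrightarrow> (\<forall>z\<in>S. a \<le> h z + t)"
proof -
  have *: "ereal a \<le> I + ereal t \<longleftrightarrow> ereal (a - t) \<le> I" for I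
    by (cases I) (auto simp: algebra_simps)
  show ?thesis
    unfolding * le_INF_iff by (auto simp: algebra_simps)
qed

lemma constraints_P_iff:
  "constraints_P X Y D g H \<tau> x y \<longleftrightarrow>
     x \<in> X \<and> y \<in> Y \<and> H x y \<in> D \<and> (\<forall>z\<in>Y. H x z \<in> D \<longrightarrow> g x y \<le> g x z + \<tau>)"
  unfolding constraints_P_def ereal_le_INF_add_iff by auto

lemma penalty_point_iff:
  "penalty_point nrm X Y D f g H \<tau> x y l \<longleftrightarrow>
     x \<in> X \<and> y \<in> Y \<and> 0 \<le> l \<and> f x y < \<infinity> \<and> H x y \<in> D \<and>
     (\<forall>z\<in>Y. g x y \<le> g x z + l * dist_to nrm (H x z) D + \<tau>)"
  unfolding penalty_point_def ereal_le_INF_add_iff ..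

text \<open>The penalty term vanishes at every \<open>z\<close> with \<open>H x z \<in> D\<close>,
  whatever the multiplier is.\<close>

lemma penalty_point_imp_feasible_P:
  assumes "is_norm nrm" "penalty_point nrm X Y D f g H \<tau> x y l"
  shows "feasible_P X Y D f g H \<tau> x y"
proof -
  have "g x y \<le> g x z + \<tau>" if "z \<in> Y" "H x z \<in> D" for z
    using assms(2) dist_to_mem[OF assms(1) that(2)] that(1) by (force simp: penalty_point_iff)
  then show ?thesis
    using assms(2) by (simp add: penalty_point_iff feasible_P_def constraints_P_iff)
qed

section \<open>Sequences\<close>

text \<open>Filling the gaps of a subsequence with the limit itself gives a full convergent
  sequence, to which hypotheses about full sequences apply.\<close>

lemma tendsto_fill_subsequence:
  fixes xs :: "nat \<Rightarrow> 'a::topological_space"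
  assumes "strict_mono (r :: nat \<Rightarrow> nat)" "xs \<longlonglongrightarrow> x"
  shows "(\<lambda>n. if n \<in> range r then xs (inv r n) else x) \<longlonglongrightarrow> x"
proof (rule topological_tendstoI)
  fix S assume S: "open S" "x \<in> S"
  then obtain K where K: "\<And>k. k \<ge> K \<Longrightarrow> xs k \<in> S"
    using topological_tendstoD[OF assms(2)] by (auto simp: eventually_sequentially)
  have "inv r n \<ge> K" if "n \<ge> r K" "n \<in> range r" for n
    using that assms(1) by (auto simp: strict_mono_less_eq inv_f_f strict_mono_imp_inj_on)
  then show "\<forall>\<^sub>F n in sequentially. (if n \<in> range r then xs (inv r n) else x) \<in> S"
    using K S unfolding eventually_sequentially by (intro exI[of _ "r K"]) auto
qed

text \<open>The distances from \<open>z\<close> to \<open>Ys n\<close> tend to zero, the distance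
  from \<open>z\<close> to \<open>Y\<close>. The slack \<open>1 / Suc n\<close> allows for distances
  that are not attained in \<open>Ys n\<close>.\<close>

lemma PK_converges_recovery:
  assumes "PK_converges Ys Y" "\<And>n. Ys n \<noteq> {}" "z \<in> Y"
  shows "\<exists>zs. (\<forall>n. zs n \<in> Ys n) \<and> zs \<longlonglongrightarrow> z"
proof -
  have "\<exists>y\<in>Ys n. dist z y < infdist z (Ys n) + 1 / Suc n" for n
  proof -
    have "(INF a\<in>Ys n. dist z a) < infdist z (Ys n) + 1 / Suc n"
      using assms(2)[of n] by (simp add: infdist_def)
    then show ?thesis
      using cINF_less_iff[OF assms(2), of "dist z" n] by (simp add: bdd_below_image_dist)
  qed
  then obtain zs where zs: "\<And>n. zs n \<in> Ys n" "\<And>n. dist z (zs n) < infdist z (Ys n) + 1 / Suc n"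
    by metis
  have "(\<lambda>n. infdist z (Ys n) + 1 / Suc n) \<longlonglongrightarrow> infdist z Y + 0"
    using assms(1) unfolding PK_converges_def
    by (intro tendsto_add LIMSEQ_Suc[OF lim_1_over_n]) auto
  then have "(\<lambda>n. infdist z (Ys n) + 1 / Suc n) \<longlonglongrightarrow> 0"
    using assms(3) by simp
  then have "(\<lambda>n. dist (zs n) z) \<longlonglongrightarrow> 0"
    by (rule Lim_null_comparison[rotated]) (use zs(2) in \<open>auto simp: dist_commute less_imp_le\<close>)
  then show ?thesis
    using zs(1) tendsto_dist_iff by blast
qed

text \<open>Once \<open>a n\<close> is positive, \<open>b n \<le> C / a n\<close>. This is how
  diverging penalty parameters force the penalized quantities to vanish.\<close>

lemma tendsto_zero_of_bounded_multiple:
  fixes a b :: "nat \<Rightarrow> real"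
  assumes "filterlim a at_top sequentially" "\<forall>\<^sub>F n in sequentially. a n * b n \<le> C" "\<And>n. 0 \<le> b n"
  shows "b \<longlonglongrightarrow> 0"
proof (rule Lim_null_comparison)
  show "\<forall>\<^sub>F n in sequentially. norm (b n) \<le> C / a n"
    using assms(2) filterlim_at_top_dense[THEN iffD1, OF assms(1), rule_format, of 0]
    by eventually_elim (use assms(3) in \<open>simp add: field_simps\<close>)
  show "(\<lambda>n. C / a n) \<longlonglongrightarrow> 0"
    using assms(1) by (intro tendsto_divide_0[OF tendsto_const] filterlim_at_top_imp_at_infinity)
qed

section \<open>The approximating problems\<close>

text \<open>The suprema in the assumptions on \<open>gs\<close> and \<open>Hs\<close> appear as
  pointwise bounds. The tolerances are not fixed here, because different claims let
  \<open>\<tau>s\<close> approach different limits.\<close>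

locale bilevel_approximation =
  fixes X :: "'x::metric_space set" and Y :: "'y::metric_space set" and D :: "'u::euclidean_space set"
    and Ys :: "nat \<Rightarrow> 'y set" and nrm :: "'u \<Rightarrow> real"
    and f :: "'x \<Rightarrow> 'y \<Rightarrow> ereal" and fs :: "nat \<Rightarrow> 'x \<Rightarrow> 'y \<Rightarrow> ereal"
    and g :: "'x \<Rightarrow> 'y \<Rightarrow> real" and gs :: "nat \<Rightarrow> 'x \<Rightarrow> 'y \<Rightarrow> real"
    and H :: "'x \<Rightarrow> 'y \<Rightarrow> 'u" and Hs :: "nat \<Rightarrow> 'x \<Rightarrow> 'y \<Rightarrow> 'u"
    and \<sigma> \<theta> lbar \<delta> \<eta> :: "nat \<Rightarrow> real"
  assumes norm: "is_norm nrm"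
    and A1: "closed X" "closed Y" "D \<noteq> {}" "closed D"
    and A2: "\<And>\<nu>. Ys \<nu> \<noteq> {}" "\<And>\<nu>. Ys \<nu> \<subseteq> Y" "PK_converges Ys Y"
    and A3: "\<delta> \<longlonglongrightarrow> 0" "\<And>\<nu> x y. x \<in> X \<Longrightarrow> y \<in> Y \<Longrightarrow> \<bar>gs \<nu> x y - g x y\<bar> \<le> \<delta> \<nu>"
      "continuous_on (X \<times> Y) (\<lambda>(x, y). g x y)"
    and A4: "\<eta> \<longlonglongrightarrow> 0"
      "\<And>\<nu> x y. x \<in> X \<Longrightarrow> y \<in> Y \<Longrightarrow>
         \<bar>dist_to nrm (Hs \<nu> x y) D - dist_to nrm (H x y) D\<bar> \<le> \<eta> \<nu>"
      "continuous_on (X \<times> Y) (\<lambda>(x, y). H x y)"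
    and A5: "\<And>x y. f x y \<noteq> -\<infinity>"
      "\<And>x y. x \<in> X \<Longrightarrow> y \<in> Y \<Longrightarrow> limsup (\<lambda>\<nu>. fs \<nu> x y) \<le> f x y"
      "\<And>x y xs ys. x \<in> X \<Longrightarrow> y \<in> Y \<Longrightarrow>
          (\<And>\<nu>. xs \<nu> \<in> X) \<Longrightarrow> xs \<longlonglongrightarrow> x \<Longrightarrow> (\<And>\<nu>. ys \<nu> \<in> Y) \<Longrightarrow> ys \<longlonglongrightarrow> y \<Longrightarrow>
          f x y \<le> liminf (\<lambda>\<nu>. fs \<nu> (xs \<nu>) (ys \<nu>))"
    and A6: "\<And>\<nu>. 0 \<le> \<sigma> \<nu>" "\<And>\<nu>. 0 \<le> \<theta> \<nu>"
      "filterlim lbar at_top sequentially"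
      "(\<lambda>\<nu>. \<sigma> \<nu> * \<eta> \<nu>) \<longlonglongrightarrow> 0" "(\<lambda>\<nu>. \<theta> \<nu> * lbar \<nu> * \<eta> \<nu>) \<longlonglongrightarrow> 0"
      "(\<lambda>\<nu>. \<theta> \<nu> * \<delta> \<nu>) \<longlonglongrightarrow> 0"
begin

abbreviation cons :: "(nat \<Rightarrow> real) \<Rightarrow> nat \<Rightarrow> 'x \<times> 'y \<times> 'u \<times> real \<times> real \<Rightarrow> bool" where
  "cons \<tau>s \<nu> \<equiv> constraints_Pnu nrm X Y D (Ys \<nu>) (gs \<nu>) (Hs \<nu>) (lbar \<nu>) (\<tau>s \<nu>)"

abbreviation obj :: "nat \<Rightarrow> 'x \<times> 'y \<times> 'u \<times> real \<times> real \<Rightarrow> ereal" where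
  "obj \<nu> \<equiv> objective_Pnu nrm (fs \<nu>) (\<sigma> \<nu>) (\<theta> \<nu>)"

abbreviation minval :: "(nat \<Rightarrow> real) \<Rightarrow> nat \<Rightarrow> ereal" where
  "minval \<tau>s \<nu> \<equiv>
     minval_Pnu nrm X Y D (Ys \<nu>) (fs \<nu>) (gs \<nu>) (Hs \<nu>) (\<sigma> \<nu>) (\<theta> \<nu>) (lbar \<nu>) (\<tau>s \<nu>)"

abbreviation epsopt :: "(nat \<Rightarrow> real) \<Rightarrow> nat \<Rightarrow> real \<Rightarrow> 'x \<times> 'y \<times> 'u \<times> real \<times> real \<Rightarrow> bool" where
  "epsopt \<tau>s \<nu> \<equiv>
     eps_optimal_Pnu nrm X Y D (Ys \<nu>) (fs \<nu>) (gs \<nu>) (Hs \<nu>) (\<sigma> \<nu>) (\<theta> \<nu>) (lbar \<nu>) (\<tau>s \<nu>)"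

section \<open>Limits of the problem data along sequences and subsequences\<close>

lemma minval_le: "cons \<tau>s \<nu> w \<Longrightarrow> minval \<tau>s \<nu> \<le> obj \<nu> w"
  unfolding minval_Pnu_def by (rule INF_lower) simp

lemma tendsto_g:
  assumes "x \<in> X" "y \<in> Y" "\<And>n::nat. xs n \<in> X" "\<And>n. ys n \<in> Y" "xs \<longlonglongrightarrow> x" "ys \<longlonglongrightarrow> y"
  shows "(\<lambda>n. g (xs n) (ys n)) \<longlonglongrightarrow> g x y"
  using continuous_on_tendsto_compose[OF A3(3) tendsto_Pair[OF assms(5,6)]] assms(1-4) by simp

lemma tendsto_dist_H:
  assumes "x \<in> X" "y \<in> Y" "\<And>n::nat. xs n \<in> X" "\<And>n. ys n \<in> Y" "xs \<longlonglongrightarrow> x" "ys \<longlonglongrightarrow> y"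
  shows "(\<lambda>n. dist_to nrm (H (xs n) (ys n)) D) \<longlonglongrightarrow> dist_to nrm (H x y) D"
  using continuous_on_tendsto_compose[OF dist_to_continuous[OF norm A1(4,3)]
      continuous_on_tendsto_compose[OF A4(3) tendsto_Pair[OF assms(5,6)]]] assms(1-4) by simp

text \<open>The lower-limit assumption concerns full sequences, so it is applied to the filled ones;
  restricting them to \<open>r\<close> recovers \<open>xs\<close> and \<open>ys\<close> and can only
  raise the lower limit.\<close>

lemma liminf_f_subsequence:
  assumes r: "strict_mono r" and "x \<in> X" "y \<in> Y"
    and "\<And>n. xs n \<in> X" "\<And>n. ys n \<in> Y" "xs \<longlonglongrightarrow> x" "ys \<longlonglongrightarrow> y"
  shows "f x y \<le> liminf (\<lambda>k. fs (r k) (xs k) (ys k))"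
proof -
  let ?x = "\<lambda>n. if n \<in> range r then xs (inv r n) else x"
  let ?y = "\<lambda>n. if n \<in> range r then ys (inv r n) else y"
  have "f x y \<le> liminf (\<lambda>n. fs n (?x n) (?y n))"
    using assms by (intro A5(3) tendsto_fill_subsequence) auto
  also have "\<dots> \<le> liminf ((\<lambda>n. fs n (?x n) (?y n)) \<circ> r)"
    by (rule liminf_subseq_mono[OF r])
  also have "\<dots> = liminf (\<lambda>k. fs (r k) (xs k) (ys k))"
    using r by (simp add: o_def inv_f_f strict_mono_imp_inj_on)
  finally show ?thesis .
qed

text \<open>The tolerance \<open>t\<close> is generic: it is an enlarged tolerance when
  \<open>Y\<close> is compact and \<open>\<tau>\<close> itself in the arguments about cluster
  points.\<close>

lemma limsup_minval_le:
  assumes pp: "penalty_point nrm X Y D f g H t x y l"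
    and t: "(\<lambda>\<nu>. \<theta> \<nu> * \<bar>\<tau>s \<nu> - t\<bar>) \<longlonglongrightarrow> 0"
  shows "limsup (minval \<tau>s) \<le> f x y"
proof -
  note pt = pp[unfolded penalty_point_iff]
  have xy: "x \<in> X" "y \<in> Y" and l: "0 \<le> l"
    and opt: "\<And>z. z \<in> Y \<Longrightarrow> g x y \<le> g x z + l * dist_to nrm (H x z) D + t"
    using pt by auto
  have \<eta>: "0 \<le> \<eta> \<nu>" and \<delta>: "0 \<le> \<delta> \<nu>" for \<nu>
    using A4(2)[OF xy, of \<nu>] A3(2)[OF xy, of \<nu>] by linarith+
  \<comment> \<open>The error budget of the lower-level constraint: \<open>\<delta>\<close> twice
    for replacing \<open>g\<close> by \<open>gs\<close> at \<open>y\<close> and at \<open>z\<close>,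
    \<open>l * \<eta>\<close> for the distance term, and the gap between the tolerances. Then
    \<open>c\<close> bounds the cost of both corrections.\<close>
  define a where "a \<nu> = 2 * \<delta> \<nu> + l * \<eta> \<nu> + \<bar>\<tau>s \<nu> - t\<bar>" for \<nu>
  define c where "c \<nu> = \<sigma> \<nu> * \<eta> \<nu> + \<theta> \<nu> * a \<nu>" for \<nu>
  have ev_l: "\<forall>\<^sub>F \<nu> in sequentially. l \<le> lbar \<nu>"
    using A6(3) by (simp add: filterlim_at_top)
  \<comment> \<open>The assumption controls the product with \<open>lbar \<nu>\<close>, which
    eventually dominates the fixed \<open>l\<close>.\<close>
  have "(\<lambda>\<nu>. \<theta> \<nu> * (l * \<eta> \<nu>)) \<longlonglongrightarrow> 0"
  proof (rule Lim_null_comparison[OF _ A6(5)])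
    show "\<forall>\<^sub>F \<nu> in sequentially. norm (\<theta> \<nu> * (l * \<eta> \<nu>)) \<le> \<theta> \<nu> * lbar \<nu> * \<eta> \<nu>"
      using ev_l by eventually_elim
        (use l \<eta> A6(2) in \<open>simp add: abs_mult mult.assoc mult_left_mono mult_right_mono\<close>)
  qed
  then have "(\<lambda>\<nu>. \<sigma> \<nu> * \<eta> \<nu> + (2 * (\<theta> \<nu> * \<delta> \<nu>) + \<theta> \<nu> * (l * \<eta> \<nu>) + \<theta> \<nu> * \<bar>\<tau>s \<nu> - t\<bar>))
      \<longlonglongrightarrow> 0 + (2 * 0 + 0 + 0)"
    by (intro tendsto_add tendsto_mult_left t A6(4,6))
  then have "c \<longlonglongrightarrow> 0"
    by (simp add: c_def[abs_def] a_def algebra_simps)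
  then have c: "(\<lambda>\<nu>. ereal (c \<nu>)) \<longlonglongrightarrow> 0"
    by (simp add: zero_ereal_def)
  have "\<forall>\<^sub>F \<nu> in sequentially. minval \<tau>s \<nu> \<le> ereal (c \<nu>) + fs \<nu> x y"
    using ev_l
  proof eventually_elim
    case (elim \<nu>)
    obtain d where d: "d \<in> D" "dist_to nrm (Hs \<nu> x y) D = nrm (Hs \<nu> x y - d)"
      using dist_to_attained[OF norm A1(4,3)] by blast
    \<comment> \<open>The shortest correction into \<open>D\<close>. Its size is the distance of
      \<open>Hs \<nu> x y\<close> to \<open>D\<close>, at most \<open>\<eta> \<nu>\<close> because
      \<open>H x y\<close> lies in \<open>D\<close>.\<close>
    define u where "u = d - Hs \<nu> x y"
    have u: "nrm u \<le> \<eta> \<nu>"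
      using A4(2)[OF xy, of \<nu>] d(2) dist_to_mem[OF norm, of "H x y" D] pt
        is_norm_uminus[OF norm, of u] by (simp add: u_def)
    have "cons \<tau>s \<nu> (x, y, u, - a \<nu>, l)"
    proof -
      have "gs \<nu> x y + - a \<nu> \<le> gs \<nu> x z + l * dist_to nrm (Hs \<nu> x z) D + \<tau>s \<nu>"
        if "z \<in> Ys \<nu>" for z
      proof -
        have z: "z \<in> Y" using that A2(2) by blast
        have "l * dist_to nrm (H x z) D \<le> l * (dist_to nrm (Hs \<nu> x z) D + \<eta> \<nu>)"
          using A4(2)[OF xy(1) z, of \<nu>] l by (intro mult_left_mono) auto
        then show ?thesis
          using A3(2)[OF xy, of \<nu>] A3(2)[OF xy(1) z, of \<nu>] opt[OF z]
          by (simp add: a_def algebra_simps)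
      qed
      moreover have "0 \<le> a \<nu>"
        using l \<eta> \<delta> by (simp add: a_def)
      ultimately show ?thesis
        using xy l elim d(1) by (simp add: constraints_Pnu_def u_def)
    qed
    then have "minval \<tau>s \<nu> \<le> fs \<nu> x y + ereal (\<sigma> \<nu> * nrm u) - ereal (\<theta> \<nu> * - a \<nu>)"
      using minval_le by (fastforce simp: objective_Pnu_def)
    also have "\<dots> = ereal (\<sigma> \<nu> * nrm u + \<theta> \<nu> * a \<nu>) + fs \<nu> x y"
      by (cases "fs \<nu> x y") auto
    also have "\<dots> \<le> ereal (c \<nu>) + fs \<nu> x y"
      using u A6(1)[of \<nu>] by (intro add_right_mono) (simp add: c_def mult_left_mono)
    finally show ?case .
  qed
  then have "limsup (minval \<tau>s) \<le> limsup (\<lambda>\<nu>. ereal (c \<nu>) + fs \<nu> x y)"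
    by (rule Limsup_mono)
  also have "\<dots> = 0 + limsup (\<lambda>\<nu>. fs \<nu> x y)"
    using c by (intro ereal_limsup_lim_add) auto
  also have "\<dots> \<le> f x y"
    using A5(2)[OF xy] by simp
  finally show ?thesis .
qed

text \<open>The objective is bounded above and its \<open>fs\<close> part is eventually bounded
  below, so the penalties stay bounded while their parameters diverge. The multipliers converge,
  hence the errors they scale vanish and the constraint passes to the limit. Dropping the
  nonnegative penalties gives the second claim.\<close>

lemma cluster_point_is_penalty_point:
  assumes r: "strict_mono r"
    and cons: "\<And>k. cons \<tau>s (r k) (w k)"
    and lim: "w \<longlonglongrightarrow> (xh, yh, uh, \<alpha>h, lh)"
    and bound: "\<forall>\<^sub>F k in sequentially. obj (r k) (w k) \<le> ereal M"
    and \<tau>: "(\<lambda>\<nu>. \<theta> \<nu> * \<bar>\<tau>s \<nu> - \<tau>\<bar>) \<longlonglongrightarrow> 0"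
    and top: "filterlim \<sigma> at_top sequentially" "filterlim \<theta> at_top sequentially"
  shows "penalty_point nrm X Y D f g H \<tau> xh yh lh"
    and "f xh yh \<le> liminf (\<lambda>k. obj (r k) (w k))"
proof -
  define xs ys us as ls where "xs k = fst (w k)" "ys k = fst (snd (w k))"
    "us k = fst (snd (snd (w k)))" "as k = fst (snd (snd (snd (w k))))"
    "ls k = snd (snd (snd (snd (w k))))" for k
  note defs = this
  have w: "w k = (xs k, ys k, us k, as k, ls k)" for k
    by (simp add: defs)
  have lims: "xs \<longlonglongrightarrow> xh" "ys \<longlonglongrightarrow> yh" "ls \<longlonglongrightarrow> lh"
    using lim[THEN tendsto_fst] lim[THEN tendsto_snd, THEN tendsto_fst]
      lim[THEN tendsto_snd, THEN tendsto_snd, THEN tendsto_snd, THEN tendsto_snd]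
    by (simp_all add: defs[abs_def])
  have in_D: "Hs (r k) (xs k) (ys k) + us k \<in> D"
    and opt: "z \<in> Ys (r k) \<Longrightarrow> gs (r k) (xs k) (ys k) + as k
      \<le> gs (r k) (xs k) z + ls k * dist_to nrm (Hs (r k) (xs k) z) D + \<tau>s (r k)"
    and mem: "xs k \<in> X" "ys k \<in> Y" "as k \<le> 0" "0 \<le> ls k" for k z
    using cons[of k] by (auto simp: constraints_Pnu_def w)
  have h: "xh \<in> X" "yh \<in> Y"
    using closed_sequentially A1(1,2) mem lims by blast+
  have lh: "0 \<le> lh"
    using lims(3) mem(4) by (intro LIMSEQ_le_const) auto
  note sub = LIMSEQ_subseq_LIMSEQ[OF _ r, unfolded o_def]
  note top_sub = filterlim_compose[OF _ filterlim_subseq[OF r]]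
  have obj_eq: "obj (r k) (w k)
      = fs (r k) (xs k) (ys k) + ereal (\<sigma> (r k) * nrm (us k) + \<theta> (r k) * - as k)" for k
    by (cases "fs (r k) (xs k) (ys k)") (auto simp: objective_Pnu_def w)
  have pos: "0 \<le> \<sigma> (r k) * nrm (us k)" "0 \<le> \<theta> (r k) * - as k" for k
    using A6(1,2) mem(3)[of k] norm
    by (auto simp: is_norm_def mult_nonneg_nonpos)
  have f_liminf: "f xh yh \<le> liminf (\<lambda>k. fs (r k) (xs k) (ys k))"
    using r h mem lims by (intro liminf_f_subsequence) auto
  also have "\<dots> \<le> liminf (\<lambda>k. obj (r k) (w k))"
  proof (intro Liminf_mono always_eventually allI)
    show "fs (r k) (xs k) (ys k) \<le> obj (r k) (w k)" for k
      unfolding obj_eq using pos[of k] by (cases "fs (r k) (xs k) (ys k)") auto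
  qed
  finally show f_le: "f xh yh \<le> liminf (\<lambda>k. obj (r k) (w k))" .
  have f_fin: "f xh yh < \<infinity>"
  proof -
    have "liminf (\<lambda>k. obj (r k) (w k)) \<le> limsup (\<lambda>k. obj (r k) (w k))"
      by (rule Liminf_le_Limsup) simp
    also have "\<dots> \<le> ereal M"
      using bound by (rule Limsup_bounded)
    finally show ?thesis
      using f_le by (auto intro: le_less_trans)
  qed
  \<comment> \<open>A real lower bound exists because \<open>f\<close> never takes the value minus
    infinity; lower semicontinuity transfers it to the tail of \<open>fs\<close>, leaving at most
    \<open>M - c\<close> for the penalties.\<close>
  obtain c where "ereal c < f xh yh"
    using ereal_dense2[of "-\<infinity>" "f xh yh"] A5(1)[of xh yh] by auto
  then have "\<forall>\<^sub>F k in sequentially. ereal c < fs (r k) (xs k) (ys k)"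
    using f_liminf by (intro less_LiminfD) (rule less_le_trans)
  with bound have "\<forall>\<^sub>F k in sequentially. \<sigma> (r k) * nrm (us k) + \<theta> (r k) * - as k \<le> M - c"
  proof eventually_elim
    case (elim k)
    then show ?case
      unfolding obj_eq by (cases "fs (r k) (xs k) (ys k)") auto
  qed
  then have "\<forall>\<^sub>F k in sequentially. \<sigma> (r k) * nrm (us k) \<le> M - c"
    and "\<forall>\<^sub>F k in sequentially. \<theta> (r k) * - as k \<le> M - c"
    by (eventually_elim, use pos in \<open>smt (verit)\<close>)+
  then have us: "(\<lambda>k. nrm (us k)) \<longlonglongrightarrow> 0" and as': "(\<lambda>k. - as k) \<longlonglongrightarrow> 0"
    using norm mem(3) tendsto_zero_of_bounded_multiple[OF top_sub[OF top(1)], of "\<lambda>k. nrm (us k)"]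
      tendsto_zero_of_bounded_multiple[OF top_sub[OF top(2)], of "\<lambda>k. - as k"]
    by (simp_all add: is_norm_def)
  have as: "as \<longlonglongrightarrow> 0"
    using tendsto_minus[OF as'] by simp
  \<comment> \<open>Since \<open>\<theta>\<close> diverges, boundedness of the scaled gap already
    yields convergence of the tolerances.\<close>
  have "(\<lambda>\<nu>. \<bar>\<tau>s \<nu> - \<tau>\<bar>) \<longlonglongrightarrow> 0"
  proof (rule tendsto_zero_of_bounded_multiple[OF top(2)])
    show "\<forall>\<^sub>F \<nu> in sequentially. \<theta> \<nu> * \<bar>\<tau>s \<nu> - \<tau>\<bar> \<le> 1"
      using order_tendstoD(2)[OF \<tau>, of 1] by (auto elim: eventually_mono)
  qed simp
  then have \<tau>s: "\<tau>s \<longlonglongrightarrow> \<tau>"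
    by (simp add: LIM_zero_iff tendsto_rabs_zero_iff)
  have "dist_to nrm (H xh yh) D \<le> 0 + 0"
  proof (rule LIMSEQ_le)
    show "(\<lambda>k. dist_to nrm (H (xs k) (ys k)) D) \<longlonglongrightarrow> dist_to nrm (H xh yh) D"
      using h mem lims by (intro tendsto_dist_H) auto
    show "(\<lambda>k. \<eta> (r k) + nrm (us k)) \<longlonglongrightarrow> 0 + 0"
      by (intro tendsto_add us sub[OF A4(1)])
    \<comment> \<open>The point \<open>Hs + u\<close> of \<open>D\<close> bounds the distance of
      \<open>Hs\<close> by \<open>nrm u\<close>; exchanging \<open>Hs\<close> for \<open>H\<close>
      costs \<open>\<eta>\<close>.\<close>
    have "dist_to nrm (H (xs k) (ys k)) D \<le> \<eta> (r k) + nrm (us k)" for k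
      using A4(2)[OF mem(1,2), of "r k" k k] dist_to_le[OF norm in_D, of "Hs (r k) (xs k) (ys k)" k]
        is_norm_uminus[OF norm, of "us k"] by simp
    then show "\<exists>N. \<forall>k\<ge>N. dist_to nrm (H (xs k) (ys k)) D \<le> \<eta> (r k) + nrm (us k)"
      by blast
  qed
  then have HD: "H xh yh \<in> D"
    using dist_to_nonneg[OF norm A1(3), of "H xh yh"] dist_to_eq_0_iff[OF norm A1(4,3)] by force
  have "g xh yh \<le> g xh z + lh * dist_to nrm (H xh z) D + \<tau>" if z: "z \<in> Y" for z
  proof -
    \<comment> \<open>The fixed \<open>z\<close> need not belong to \<open>Ys (r k)\<close>, so the
      constraint is tested at approximating points \<open>zs (r k)\<close>.\<close>
    obtain zs where zs: "\<And>n. zs n \<in> Ys n" "zs \<longlonglongrightarrow> z"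
      using PK_converges_recovery[OF A2(3,1) z] by blast
    have zY: "zs n \<in> Y" for n
      using zs(1) A2(2) by blast
    have "g xh yh + 0 \<le> g xh z + lh * (dist_to nrm (H xh z) D + 0) + \<tau> + 2 * 0"
    proof (rule LIMSEQ_le)
      show "(\<lambda>k. g (xs k) (ys k) + as k) \<longlonglongrightarrow> g xh yh + 0"
        using h mem lims by (intro tendsto_add tendsto_g as) auto
      show "(\<lambda>k. g (xs k) (zs (r k)) + ls k * (dist_to nrm (H (xs k) (zs (r k))) D + \<eta> (r k))
          + \<tau>s (r k) + 2 * \<delta> (r k))
        \<longlonglongrightarrow> g xh z + lh * (dist_to nrm (H xh z) D + 0) + \<tau> + 2 * 0"
        using h mem z zY lims
        by (intro tendsto_add tendsto_mult tendsto_const tendsto_g tendsto_dist_H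
            sub[OF A4(1)] sub[OF A3(1)] sub[OF \<tau>s] sub[OF zs(2)]) auto
      have "g (xs k) (ys k) + as k \<le> g (xs k) (zs (r k))
          + ls k * (dist_to nrm (H (xs k) (zs (r k))) D + \<eta> (r k)) + \<tau>s (r k) + 2 * \<delta> (r k)" for k
      proof -
        have "ls k * dist_to nrm (Hs (r k) (xs k) (zs (r k))) D
            \<le> ls k * (dist_to nrm (H (xs k) (zs (r k))) D + \<eta> (r k))"
          using A4(2)[OF mem(1) zY, of "r k" k "r k"] mem(4) by (intro mult_left_mono) auto
        then show ?thesis
          using opt[OF zs(1), of k] A3(2)[OF mem(1,2), of "r k" k k]
            A3(2)[OF mem(1) zY, of "r k" k "r k"] by linarith
      qed
      then show "\<exists>N. \<forall>k\<ge>N. g (xs k) (ys k) + as k \<le> g (xs k) (zs (r k))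
          + ls k * (dist_to nrm (H (xs k) (zs (r k))) D + \<eta> (r k)) + \<tau>s (r k) + 2 * \<delta> (r k)"
        by blast
    qed
    then show ?thesis by simp
  qed
  then show "penalty_point nrm X Y D f g H \<tau> xh yh lh"
    using h lh f_fin HD by (simp add: penalty_point_iff)
qed

text \<open>Exact penalization at level \<open>g x y - \<tau>'\<close>, strictly below the bound
  \<open>g x y - \<tau>\<close> valid on the constraint set; enlarging the tolerance provides the
  required gap.\<close>

lemma exists_multiplier:
  assumes "compact Y" "x \<in> X" "\<tau> < \<tau>'" "y \<in> Y"
    and "\<And>z. z \<in> Y \<Longrightarrow> H x z \<in> D \<Longrightarrow> g x y \<le> g x z + \<tau>"
  shows "\<exists>l\<ge>0. \<forall>z\<in>Y. g x y \<le> g x z + l * dist_to nrm (H x z) D + \<tau>'"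
proof -
  have "continuous_on Y (\<lambda>z. g x z)" "continuous_on Y (\<lambda>z. dist_to nrm (H x z) D)"
    using assms(2) tendsto_g[OF assms(2)] tendsto_dist_H[OF assms(2)]
    by (auto simp: continuous_on_sequentially o_def)
  then have "\<exists>l\<ge>0. \<forall>z\<in>Y. g x y - \<tau>' \<le> g x z + l * dist_to nrm (H x z) D"
    using assms dist_to_nonneg[OF norm A1(3)] dist_to_eq_0_iff[OF norm A1(4,3)]
    by (intro exists_penalty_parameter[where V = "g x y - \<tau>"]) (auto simp: algebra_simps)
  then show ?thesis
    by (simp add: algebra_simps)
qed

text \<open>Every constrained point of (P) with finite value is a penalty point for the larger
  tolerance. Its multiplier may depend on the point, since the resulting bound does not contain
  it.\<close>

lemma limsup_minval_le_minval_P: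
  assumes "compact Y" "\<tau> < \<tau>'" "(\<lambda>\<nu>. \<theta> \<nu> * \<bar>\<tau>s \<nu> - \<tau>'\<bar>) \<longlonglongrightarrow> 0"
  shows "limsup (minval \<tau>s) \<le> minval_P X Y D f g H \<tau>"
proof -
  have "limsup (minval \<tau>s) \<le> f x y" if "constraints_P X Y D g H \<tau> x y" for x y
  proof (cases "f x y < \<infinity>")
    case True
    obtain l where "l \<ge> 0" "\<forall>z\<in>Y. g x y \<le> g x z + l * dist_to nrm (H x z) D + \<tau>'"
      using exists_multiplier[OF assms(1) _ assms(2), of x y] \<open>constraints_P X Y D g H \<tau> x y\<close>
      by (auto simp: constraints_P_iff)
    then have "penalty_point nrm X Y D f g H \<tau>' x y l"
      using that True by (simp add: penalty_point_iff constraints_P_iff)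
    then show ?thesis
      using assms(3) by (rule limsup_minval_le)
  qed simp
  then show ?thesis
    unfolding minval_P_def by (auto intro!: INF_greatest)
qed

text \<open>Along a subsequence realizing the lower limit, compactness of \<open>B\<close> gives a
  cluster point of optimal solutions. It is feasible in (P) and its value is at most the lower
  limit.\<close>

lemma minval_P_le_liminf_minval:
  assumes "compact B" and ex: "\<And>\<nu>. \<exists>w\<in>B. epsopt \<tau>s \<nu> 0 w"
    and \<tau>: "(\<lambda>\<nu>. \<theta> \<nu> * \<bar>\<tau>s \<nu> - \<tau>\<bar>) \<longlonglongrightarrow> 0"
    and top: "filterlim \<sigma> at_top sequentially" "filterlim \<theta> at_top sequentially"
  shows "minval_P X Y D f g H \<tau> \<le> liminf (minval \<tau>s)" (is ?A)
    and "\<bar>liminf (minval \<tau>s)\<bar> \<noteq> \<infinity> \<Longrightarrow> \<exists>r. minval \<tau>s \<longlonglongrightarrow> ereal r"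
proof -
  \<comment> \<open>A lower limit below infinity supplies the real bound \<open>M\<close> on the
    objective values; otherwise the first claim is trivial.\<close>
  have main: "?A \<and> minval \<tau>s \<longlonglongrightarrow> liminf (minval \<tau>s)" if "liminf (minval \<tau>s) < \<infinity>"
  proof -
    obtain w where w: "\<And>\<nu>. w \<nu> \<in> B" "\<And>\<nu>. epsopt \<tau>s \<nu> 0 (w \<nu>)"
      using ex by metis
    have cons: "cons \<tau>s \<nu> (w \<nu>)" and obj: "obj \<nu> (w \<nu>) = minval \<tau>s \<nu>" for \<nu>
      using w(2)[of \<nu>] minval_le[where w = "w \<nu>" and \<nu> = \<nu> and \<tau>s = \<tau>s] by (auto simp: eps_optimal_Pnu_def)
    obtain r where r: "strict_mono r" "(minval \<tau>s \<circ> r) \<longlonglongrightarrow> liminf (minval \<tau>s)"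
      using liminf_subseq_lim by blast
    have "\<forall>k. (w \<circ> r) k \<in> B" using w(1) by simp
    then obtain wh s where s: "strict_mono s" "(w \<circ> r \<circ> s) \<longlonglongrightarrow> wh"
      using \<open>compact B\<close> unfolding compact_eq_seq_compact_metric seq_compact_def by metis
    define q where "q = r \<circ> s"
    have q: "strict_mono q"
      using r(1) s(1) by (simp add: q_def strict_mono_o)
    obtain xh yh uh ah lh where wh: "wh = (xh, yh, uh, ah, lh)"
      by (metis prod.exhaust)
    have lim: "(\<lambda>k. w (q k)) \<longlonglongrightarrow> (xh, yh, uh, ah, lh)"
      using s(2) by (simp add: q_def o_def wh)
    have obj_lim: "(\<lambda>k. obj (q k) (w (q k))) \<longlonglongrightarrow> liminf (minval \<tau>s)"
      using LIMSEQ_subseq_LIMSEQ[OF r(2) s(1)] by (simp add: obj q_def o_def)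
    obtain M where "liminf (minval \<tau>s) < ereal M"
      using ereal_dense2[OF \<open>liminf (minval \<tau>s) < \<infinity>\<close>] by blast
    then have "\<forall>\<^sub>F k in sequentially. obj (q k) (w (q k)) \<le> ereal M"
      using order_tendstoD(2)[OF obj_lim] less_imp_le by (blast intro: eventually_mono)
    note cl = cluster_point_is_penalty_point[OF q cons lim this \<tau> top]
    have f_le: "f xh yh \<le> liminf (minval \<tau>s)"
      using cl(2) lim_imp_Liminf[OF _ obj_lim] by simp
    have "constraints_P X Y D g H \<tau> xh yh"
      using penalty_point_imp_feasible_P[OF norm cl(1)] by (simp add: feasible_P_def)
    then have "minval_P X Y D f g H \<tau> \<le> f xh yh"
      unfolding minval_P_def by (auto intro: INF_lower2)
    \<comment> \<open>The cluster point is even a penalty point, so its value also bounds the upper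
      limit; both limits then coincide.\<close>
    moreover have "limsup (minval \<tau>s) \<le> f xh yh"
      using cl(1) \<tau> by (rule limsup_minval_le)
    ultimately show ?thesis
      using f_le Liminf_le_Limsup[of sequentially "minval \<tau>s"]
      by (intro conjI order_trans[OF _ f_le] Liminf_eq_Limsup) auto
  qed
  then show ?A
    by (cases "liminf (minval \<tau>s) < \<infinity>") auto
  show "\<exists>r. minval \<tau>s \<longlonglongrightarrow> ereal r" if "\<bar>liminf (minval \<tau>s)\<bar> \<noteq> \<infinity>"
    using main that by (cases "liminf (minval \<tau>s)") auto
qed

text \<open>The given penalty point keeps the minimum values eventually below a real
  \<open>M\<close>, hence the near-optimal objective values below \<open>M + E\<close>.\<close>

lemma cluster_point_feasible:
  assumes \<tau>: "(\<lambda>\<nu>. \<theta> \<nu> * \<bar>\<tau>s \<nu> - \<tau>\<bar>) \<longlonglongrightarrow> 0"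
    and top: "filterlim \<sigma> at_top sequentially" "filterlim \<theta> at_top sequentially"
    and pp: "penalty_point nrm X Y D f g H \<tau> x y l"
    and opt: "\<And>\<nu>. epsopt \<tau>s \<nu> (\<epsilon> \<nu>) (w \<nu>)" and "bounded (range \<epsilon>)"
    and r: "strict_mono r" and lim: "(\<lambda>k. w (r k)) \<longlonglongrightarrow> (xh, yh, uh, \<alpha>h, lh)"
  shows "feasible_P X Y D f g H \<tau> xh yh"
proof -
  obtain E where E: "\<And>\<nu>. \<epsilon> \<nu> \<le> E"
    using \<open>bounded (range \<epsilon>)\<close> unfolding bounded_iff by (metis abs_le_D1 rangeI real_norm_def)
  have "limsup (minval \<tau>s) < \<infinity>"
    using limsup_minval_le[OF pp \<tau>] pp by (auto simp: penalty_point_iff intro: le_less_trans)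
  then obtain M where "limsup (minval \<tau>s) < ereal M"
    using ereal_dense2 by blast
  then have ev: "\<forall>\<^sub>F \<nu> in sequentially. minval \<tau>s \<nu> < ereal M"
    by (rule Limsup_lessD)
  have "\<forall>\<^sub>F \<nu> in sequentially. obj \<nu> (w \<nu>) \<le> ereal (M + E)"
    using ev
  proof eventually_elim
    case (elim \<nu>)
    have "obj \<nu> (w \<nu>) \<le> minval \<tau>s \<nu> + ereal (\<epsilon> \<nu>)"
      using opt by (simp add: eps_optimal_Pnu_def)
    also have "\<dots> \<le> ereal M + ereal E"
      using elim E by (intro add_mono) auto
    finally show ?case by simp
  qed
  then have "\<forall>\<^sub>F k in sequentially. obj (r k) (w (r k)) \<le> ereal (M + E)"
    by (rule eventually_compose_filterlim[OF _ filterlim_subseq[OF r]])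
  moreover have "cons \<tau>s \<nu> (w \<nu>)" for \<nu>
    using opt by (simp add: eps_optimal_Pnu_def)
  ultimately have "penalty_point nrm X Y D f g H \<tau> xh yh lh"
    using r lim \<tau> top by (intro cluster_point_is_penalty_point(1)) auto
  then show ?thesis
    by (rule penalty_point_imp_feasible_P[OF norm])
qed

text \<open>The given \<open>y\<close> may exhaust the tolerance, so it is replaced by an exact
  lower-level minimizer \<open>y'\<close>. The whole of \<open>\<tau>\<close> is then available as
  the gap for \<open>exists_multiplier\<close>, and \<open>f x y'\<close> is finite because
  \<open>f\<close> is real-valued.\<close>

lemma exists_penalty_point:
  assumes "compact Y" "0 < \<tau>" and fin: "\<And>x y. \<bar>f x y\<bar> \<noteq> \<infinity>" and "feasible_P X Y D f g H \<tau> x y"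
  shows "\<exists>y l. penalty_point nrm X Y D f g H \<tau> x y l"
proof -
  define K where "K = {z \<in> Y. H x z \<in> D}"
  have x: "x \<in> X" and K_ne: "K \<noteq> {}"
    using assms(4) by (auto simp: feasible_P_def constraints_P_iff K_def)
  have "continuous_on Y (\<lambda>z. g x z)"
    using tendsto_g[OF x] x by (auto simp: continuous_on_sequentially o_def)
  then have "continuous_on K (\<lambda>z. g x z)"
    by (rule continuous_on_subset) (auto simp: K_def)
  moreover have "compact K"
  proof -
    have "continuous_on Y (\<lambda>z. H x z)"
      using x by (intro continuous_on_compose2[OF A4(3), of _ "\<lambda>z. (x, z)", simplified]
          continuous_intros) auto
    then have "closed K"
      using continuous_closed_preimage[OF _ A1(2,4)] by (simp add: K_def vimage_def Int_def)
    then show ?thesis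
      using compact_Int_closed[OF assms(1), of K] by (simp add: K_def Int_def)
  qed
  ultimately obtain y' where y': "y' \<in> K" "\<And>z. z \<in> K \<Longrightarrow> g x y' \<le> g x z"
    using continuous_attains_inf[OF _ K_ne] by blast
  then obtain l where "l \<ge> 0" "\<forall>z\<in>Y. g x y' \<le> g x z + l * dist_to nrm (H x z) D + \<tau>"
    using exists_multiplier[OF assms(1) x \<open>0 < \<tau>\<close>, of y'] by (auto simp: K_def)
  then have "penalty_point nrm X Y D f g H \<tau> x y' l"
    using x y'(1) fin[of x y'] by (auto simp: penalty_point_iff K_def)
  then show ?thesis by blast
qed

end

theorem theorem2p2:
  fixes X :: "(real ^ 'n) set" and Y :: "(real ^ 'm) set" and D :: "(real ^ 'q) set"
    and Ys :: "nat \<Rightarrow> (real ^ 'm) set"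
    and nrm :: "real ^ 'q \<Rightarrow> real"
    and f :: "real ^ 'n \<Rightarrow> real ^ 'm \<Rightarrow> ereal" and fs :: "nat \<Rightarrow> real ^ 'n \<Rightarrow> real ^ 'm \<Rightarrow> ereal"
    and g :: "real ^ 'n \<Rightarrow> real ^ 'm \<Rightarrow> real" and gs :: "nat \<Rightarrow> real ^ 'n \<Rightarrow> real ^ 'm \<Rightarrow> real"
    and H :: "real ^ 'n \<Rightarrow> real ^ 'm \<Rightarrow> real ^ 'q"
    and Hs :: "nat \<Rightarrow> real ^ 'n \<Rightarrow> real ^ 'm \<Rightarrow> real ^ 'q"
    and \<tau> :: real and \<tau>s \<sigma> \<theta> lbar \<delta> \<eta> :: "nat \<Rightarrow> real"
  assumes norm: "is_norm nrm"
    and tau: "0 \<le> \<tau>" "\<And>\<nu>. 0 \<le> \<tau>s \<nu>"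
    and A1: "X \<noteq> {}" "closed X" "Y \<noteq> {}" "closed Y" "D \<noteq> {}" "closed D"
    and A2: "\<And>\<nu>. Ys \<nu> \<noteq> {}" "\<And>\<nu>. Ys \<nu> \<subseteq> Y" "PK_converges Ys Y"
    and A3: "\<delta> \<longlonglongrightarrow> 0"
      "\<And>\<nu>. (SUP (x, y)\<in>X \<times> Y. ereal \<bar>gs \<nu> x y - g x y\<bar>) \<le> ereal (\<delta> \<nu>)"
      "continuous_on (X \<times> Y) (\<lambda>(x, y). g x y)"
    and A4: "\<eta> \<longlonglongrightarrow> 0"
      "\<And>\<nu>. (SUP (x, y)\<in>X \<times> Y.
               ereal \<bar>dist_to nrm (Hs \<nu> x y) D - dist_to nrm (H x y) D\<bar>) \<le> ereal (\<eta> \<nu>)"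
      "continuous_on (X \<times> Y) (\<lambda>(x, y). H x y)"
    and A5: "\<And>x y. f x y \<noteq> -\<infinity>" "\<And>\<nu> x y. fs \<nu> x y \<noteq> -\<infinity>"
      "\<And>x y. x \<in> X \<Longrightarrow> y \<in> Y \<Longrightarrow> limsup (\<lambda>\<nu>. fs \<nu> x y) \<le> f x y"
      "\<And>x y xs ys. x \<in> X \<Longrightarrow> y \<in> Y \<Longrightarrow>
          (\<And>\<nu>. xs \<nu> \<in> X) \<Longrightarrow> xs \<longlonglongrightarrow> x \<Longrightarrow> (\<And>\<nu>. ys \<nu> \<in> Y) \<Longrightarrow> ys \<longlonglongrightarrow> y \<Longrightarrow>
          f x y \<le> liminf (\<lambda>\<nu>. fs \<nu> (xs \<nu>) (ys \<nu>))"
    and A6: "\<And>\<nu>. 0 \<le> \<sigma> \<nu>" "\<And>\<nu>. 0 \<le> \<theta> \<nu>" "\<And>\<nu>. 0 \<le> lbar \<nu>"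
      "filterlim lbar at_top sequentially"
      "(\<lambda>\<nu>. \<sigma> \<nu> * \<eta> \<nu>) \<longlonglongrightarrow> 0" "(\<lambda>\<nu>. \<theta> \<nu> * lbar \<nu> * \<eta> \<nu>) \<longlonglongrightarrow> 0"
      "(\<lambda>\<nu>. \<theta> \<nu> * \<delta> \<nu>) \<longlonglongrightarrow> 0"
  shows
    "((\<exists>c>0. \<forall>\<nu>. c \<le> \<theta> \<nu>) \<and> (\<exists>\<tau>'>\<tau>. (\<lambda>\<nu>. \<theta> \<nu> * \<bar>\<tau>s \<nu> - \<tau>'\<bar>) \<longlonglongrightarrow> 0) \<and> compact Y
       \<longrightarrow> limsup (\<lambda>\<nu>. minval_Pnu nrm X Y D (Ys \<nu>) (fs \<nu>) (gs \<nu>) (Hs \<nu>) (\<sigma> \<nu>) (\<theta> \<nu>) (lbar \<nu>) (\<tau>s \<nu>))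
           \<le> minval_P X Y D f g H \<tau>)
     \<and>
     ((\<exists>B :: ((real ^ 'n) \<times> (real ^ 'm) \<times> (real ^ 'q) \<times> real \<times> real) set. compact B \<and>
         (\<forall>\<nu>. \<exists>w\<in>B. optimal_Pnu nrm X Y D (Ys \<nu>) (fs \<nu>) (gs \<nu>) (Hs \<nu>) (\<sigma> \<nu>) (\<theta> \<nu>) (lbar \<nu>) (\<tau>s \<nu>) w)) \<and>
      (\<lambda>\<nu>. \<theta> \<nu> * \<bar>\<tau>s \<nu> - \<tau>\<bar>) \<longlonglongrightarrow> 0 \<and>
      filterlim \<sigma> at_top sequentially \<and> filterlim \<theta> at_top sequentially
       \<longrightarrow> minval_P X Y D f g H \<tau>
             \<le> liminf (\<lambda>\<nu>. minval_Pnu nrm X Y D (Ys \<nu>) (fs \<nu>) (gs \<nu>) (Hs \<nu>) (\<sigma> \<nu>) (\<theta> \<nu>) (lbar \<nu>) (\<tau>s \<nu>)) \<and>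
           (\<bar>liminf (\<lambda>\<nu>. minval_Pnu nrm X Y D (Ys \<nu>) (fs \<nu>) (gs \<nu>) (Hs \<nu>) (\<sigma> \<nu>) (\<theta> \<nu>) (lbar \<nu>) (\<tau>s \<nu>))\<bar> \<noteq> \<infinity>
             \<longrightarrow> (\<exists>r :: real.
                   (\<lambda>\<nu>. minval_Pnu nrm X Y D (Ys \<nu>) (fs \<nu>) (gs \<nu>) (Hs \<nu>) (\<sigma> \<nu>) (\<theta> \<nu>) (lbar \<nu>) (\<tau>s \<nu>))
                     \<longlonglongrightarrow> ereal r)))
     \<and>
     ((\<lambda>\<nu>. \<theta> \<nu> * \<bar>\<tau>s \<nu> - \<tau>\<bar>) \<longlonglongrightarrow> 0 \<and>
      filterlim \<sigma> at_top sequentially \<and> filterlim \<theta> at_top sequentially \<and>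
      (\<exists>x y l. penalty_point nrm X Y D f g H \<tau> x y l)
       \<longrightarrow> (\<forall>(w :: nat \<Rightarrow> (real ^ 'n) \<times> (real ^ 'm) \<times> (real ^ 'q) \<times> real \<times> real) (\<epsilon> :: nat \<Rightarrow> real) (N :: nat set)
              xh yh uh \<alpha>h lh.
             (\<forall>\<nu>. 0 \<le> \<epsilon> \<nu>) \<and>
             (\<forall>\<nu>. eps_optimal_Pnu nrm X Y D (Ys \<nu>) (fs \<nu>) (gs \<nu>) (Hs \<nu>) (\<sigma> \<nu>) (\<theta> \<nu>) (lbar \<nu>) (\<tau>s \<nu>) (\<epsilon> \<nu>) (w \<nu>)) \<and>
             bounded (range \<epsilon>) \<and> infinite N \<and>
             (\<lambda>k. w (enumerate N k)) \<longlonglongrightarrow> (xh, yh, uh, \<alpha>h, lh)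
              \<longrightarrow> feasible_P X Y D f g H \<tau> xh yh))
     \<and>
     (compact Y \<and> 0 < \<tau> \<and> (\<forall>x y. \<bar>f x y\<bar> \<noteq> \<infinity>) \<and> (\<exists>x y. feasible_P X Y D f g H \<tau> x y)
       \<longrightarrow> (\<exists>x y l. penalty_point nrm X Y D f g H \<tau> x y l))"
proof -
  have g_bound: "\<bar>gs \<nu> x y - g x y\<bar> \<le> \<delta> \<nu>" if "x \<in> X" "y \<in> Y" for \<nu> x y
    using order_trans[OF SUP_upper[of "(x, y)"] A3(2)[of \<nu>]] that by simp
  have H_bound: "\<bar>dist_to nrm (Hs \<nu> x y) D - dist_to nrm (H x y) D\<bar> \<le> \<eta> \<nu>"
    if "x \<in> X" "y \<in> Y" for \<nu> x y
    using order_trans[OF SUP_upper[of "(x, y)"] A4(2)[of \<nu>]] that by simp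
  interpret bilevel_approximation X Y D Ys nrm f fs g gs H Hs \<sigma> \<theta> lbar \<delta> \<eta>
    by unfold_locales (fact norm A1 A2 A3(1,3) g_bound A4(1,3) H_bound A5 A6)+
  show ?thesis
  \<comment> \<open>Only conjunctions whose left side is an implication are split, so the two
    conclusions about the lower limit stay in one case.\<close>
  proof (intro conjI[of "_ \<longrightarrow> _"] impI allI, goal_cases)
    case 1
    then obtain \<tau>' where "\<tau> < \<tau>'" "(\<lambda>\<nu>. \<theta> \<nu> * \<bar>\<tau>s \<nu> - \<tau>'\<bar>) \<longlonglongrightarrow> 0" "compact Y"
      by blast
    then show ?case
      by (intro limsup_minval_le_minval_P)
  next
    case 2
    then obtain B where "compact B" "\<And>\<nu>. \<exists>w\<in>B. epsopt \<tau>s \<nu> 0 w"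
      "(\<lambda>\<nu>. \<theta> \<nu> * \<bar>\<tau>s \<nu> - \<tau>\<bar>) \<longlonglongrightarrow> 0"
      "filterlim \<sigma> at_top sequentially" "filterlim \<theta> at_top sequentially"
      by blast
    from minval_P_le_liminf_minval[OF this] show ?case
      by blast
  next
    \<comment> \<open>Enumerating the infinite index set \<open>N\<close> increasingly yields the
      strictly monotone subsequence.\<close>
    case (3 w \<epsilon> N xh yh uh \<alpha>h lh)
    then obtain x y l where "(\<lambda>\<nu>. \<theta> \<nu> * \<bar>\<tau>s \<nu> - \<tau>\<bar>) \<longlonglongrightarrow> 0"
      "filterlim \<sigma> at_top sequentially" "filterlim \<theta> at_top sequentially"
      "penalty_point nrm X Y D f g H \<tau> x y l" "\<And>\<nu>. epsopt \<tau>s \<nu> (\<epsilon> \<nu>) (w \<nu>)"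
      "bounded (range \<epsilon>)" "strict_mono (enumerate N)"
      "(\<lambda>k. w (enumerate N k)) \<longlonglongrightarrow> (xh, yh, uh, \<alpha>h, lh)"
      using strict_mono_enumerate by blast
    then show ?case
      by (rule cluster_point_feasible)
  next
    case 4
    then obtain x y where "compact Y" "0 < \<tau>" "\<And>x y. \<bar>f x y\<bar> \<noteq> \<infinity>"
      "feasible_P X Y D f g H \<tau> x y"
      by blast
    from exists_penalty_point[OF this] show ?case
      by blast
  qed
qed

end
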